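(* Let $G$ be a primitive permutation group of degree $n\ge 2$, let $l$ be an integer with $2\le l\le n$ and let $d$ be the smallest valency of an orbital graph for $G$. Then $G$ possesses the $(2,l)$-universal transversal property if and only if $l\ge n-d+1$. Equivalently, $t(G,2)=n-d+1$.
   Context: A permutation group of degree $n$ is a subgroup $G$ of the symmetric group on a finite set $\Omega$ with $|\Omega|=n$, acting on the right. $G$ is primitive if it preserves no partition of $\Omega$ other than the partition into singletons and the partition with one part (by convention the trivial group on two points is primitive). An orbital graph for $G$ is an (undirected) graph with vertex set $\Omega$ whose edge set is a $G$-orbit on $2$-subsets of $\Omega$. A $k$-partition of a set is a partition into $k$ non-empty parts; a transversal for it is a set meeting each part in exactly one point. For $1\le k\le l\le n$, $G$ has the $(k,l)$-universal transversal property ($(k,l)$-ut) if for every $k$-subset $A$ of $\Omega$, every $l$-subset $B$ of $\Omega$ and every $k$-partition $P$ of $B$ there is $g\in G$ such that $Ag$ is a transversal for $P$. For a group $G$ with the $(k,n)$-ut property, $t(G,k)$ denotes the threshold integer such that, for $k\le l\le n$, $G$ has $(k,l)$-ut if and only if $l\ge t(G,k)$ (it exists because $(k,l)$-ut implies $(k,m)$-ut for $l\le m\le n$). Every primitive group has the $(2,n)$-ut property. *)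

theory Defs
  imports "HOL-Algebra.Bij" "HOL-Algebra.Group_Action" "HOL-Library.Disjoint_Sets"
begin

text \<open>
  \<^const>\<open>BijGroup\<close> multiplies by composing functions from right to left. For groups acting
  on the right the product is reversed, but subgroups, orbits and images of sets are
  the same: the image \<open>Ag\<close> is written \<open>g ` A\<close>.
\<close>

definition permutation_group :: "'a set \<Rightarrow> ('a \<Rightarrow> 'a) set \<Rightarrow> bool" where
  "permutation_group \<Omega> G \<longleftrightarrow> finite \<Omega> \<and> subgroup G (BijGroup \<Omega>)"

definition preserves_partition :: "('a \<Rightarrow> 'a) set \<Rightarrow> 'a set set \<Rightarrow> bool" where
  "preserves_partition G P \<longleftrightarrow> (\<forall>g\<in>G. (\<lambda>X. g ` X) ` P = P)"

text \<open>
  Transitivity is not required separately: the partition into orbits is preserved, so it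
  follows for degree at least 3. The trivial group on two points is primitive
  under this definition, as intended.
\<close>

definition primitive_group :: "'a set \<Rightarrow> ('a \<Rightarrow> 'a) set \<Rightarrow> bool" where
  "primitive_group \<Omega> G \<longleftrightarrow> permutation_group \<Omega> G \<and>
     (\<forall>P. partition_on \<Omega> P \<and> preserves_partition G P \<longrightarrow>
        P = (\<lambda>x. {x}) ` \<Omega> \<or> P = {\<Omega>})"

text \<open>
  A graph with vertex set \<open>\<Omega>\<close> is given by its set of edges, which are 2-subsets of \<open>\<Omega>\<close>.
\<close>

definition orbital_graphs :: "'a set \<Rightarrow> ('a \<Rightarrow> 'a) set \<Rightarrow> 'a set set set" where
  "orbital_graphs \<Omega> G =
     orbits (BijGroup \<Omega>\<lparr>carrier := G\<rparr>) {A. A \<subseteq> \<Omega> \<and> card A = 2} (\<lambda>g A. g ` A)"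

definition has_valency :: "'a set \<Rightarrow> 'a set set \<Rightarrow> nat \<Rightarrow> bool" where
  "has_valency \<Omega> E r \<longleftrightarrow> (\<forall>v\<in>\<Omega>. card {e \<in> E. v \<in> e} = r)"

text \<open>
  Every orbital graph of a primitive group of degree at least 2 is regular, so each one
  contributes exactly one valency to this minimum.
\<close>

definition min_orbital_valency :: "'a set \<Rightarrow> ('a \<Rightarrow> 'a) set \<Rightarrow> nat" where
  "min_orbital_valency \<Omega> G = (LEAST r. \<exists>E\<in>orbital_graphs \<Omega> G. has_valency \<Omega> E r)"

definition k_partition :: "nat \<Rightarrow> 'a set \<Rightarrow> 'a set set \<Rightarrow> bool" where
  "k_partition k B P \<longleftrightarrow> partition_on B P \<and> finite P \<and> card P = k"

definition transversal :: "'a set set \<Rightarrow> 'a set \<Rightarrow> bool" where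
  "transversal P T \<longleftrightarrow> (\<forall>X\<in>P. \<exists>!x. x \<in> T \<inter> X)"

definition universal_transversal ::
  "'a set \<Rightarrow> ('a \<Rightarrow> 'a) set \<Rightarrow> nat \<Rightarrow> nat \<Rightarrow> bool" where
  "universal_transversal \<Omega> G k l \<longleftrightarrow>
     (\<forall>A B P. A \<subseteq> \<Omega> \<and> card A = k \<and> B \<subseteq> \<Omega> \<and> card B = l \<and> k_partition k B P \<longrightarrow>
        (\<exists>g\<in>G. transversal P (g ` A)))"

text \<open>
  For \<open>1 \<le> k\<close> and \<open>G\<close> with the \<open>(k,n)\<close>-universal transversal property. The bounds on \<open>t\<close>
  make it unique: \<open>t \<le> n\<close> is forced by the \<open>(k,n)\<close>-property, while \<open>k \<le> t\<close> excludes the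
  smaller numbers that would serve equally well when \<open>G\<close> has the \<open>(k,k)\<close>-property.
\<close>

definition ut_threshold :: "'a set \<Rightarrow> ('a \<Rightarrow> 'a) set \<Rightarrow> nat \<Rightarrow> nat" where
  "ut_threshold \<Omega> G k =
     (THE t. k \<le> t \<and> t \<le> card \<Omega> \<and>
        (\<forall>l. k \<le> l \<and> l \<le> card \<Omega> \<longrightarrow> (universal_transversal \<Omega> G k l \<longleftrightarrow> t \<le> l)))"

end

theory Submission imports Defs begin

text \<open>
  For a 2-subset \<open>A\<close> with orbit \<open>E\<close> and a set \<open>B\<close> divided into two parts \<open>X\<close> and \<open>Y\<close>, some image
  of \<open>A\<close> is a transversal exactly when an edge of the orbital graph \<open>E\<close> joins \<open>X\<close> to \<open>Y\<close>. So the
  \<open>(2,l)\<close>-property says that all orbital graphs stay connected when any \<open>n - l\<close> vertices are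
  deleted, and the claim is that an orbital graph of valency \<open>r\<close> has vertex connectivity \<open>r\<close>.

  In an orbital graph of valency \<open>d\<close>, deleting the neighbours of a vertex isolates it, so the property fails for
  \<open>l \<le> n - d\<close>. For the converse, the argument of Watkins and Mader is used. Consider the vertex
  sets \<open>X\<close> that do not reach all other vertices by a single edge. Among those whose boundary is
  as small as possible, take one, an atom, with the fewest vertices. Since the size of the
  boundary is submodular, distinct atoms are disjoint (\<open>atoms_disjoint\<close>). Automorphisms permute
  the atoms, so an atom is a block for the group, and for a primitive group it must be a single
  vertex (\<open>primitive_block\<close>). Hence no separating set has a boundary smaller than the
  neighbourhood of that vertex (\<open>orbital_graph_connectivity\<close>).
\<close>

section \<open>Neighbourhoods and atoms of a finite graph\<close>

definition nbhd :: "'a set set \<Rightarrow> 'a set \<Rightarrow> 'a set" where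
  "nbhd E X = {y. y \<notin> X \<and> (\<exists>x\<in>X. {x, y} \<in> E)}"

definition separating :: "'a set \<Rightarrow> 'a set set \<Rightarrow> 'a set \<Rightarrow> bool" where
  "separating V E X \<longleftrightarrow> X \<subseteq> V \<and> X \<noteq> {} \<and> V - X - nbhd E X \<noteq> {}"

definition atom :: "'a set \<Rightarrow> 'a set set \<Rightarrow> 'a set \<Rightarrow> bool" where
  "atom V E A \<longleftrightarrow> separating V E A \<and>
     (\<forall>X. separating V E X \<longrightarrow> card (nbhd E A) \<le> card (nbhd E X) \<and>
        (card (nbhd E X) = card (nbhd E A) \<longrightarrow> card A \<le> card X))"

lemma nbhd_subset: "\<Union>E \<subseteq> V \<Longrightarrow> nbhd E X \<subseteq> V"
  unfolding nbhd_def by blast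

lemma nbhd_disjoint: "X \<inter> nbhd E X = {}"
  unfolding nbhd_def by blast

text \<open>A point of \<open>nbhd E (A \<inter> B)\<close> that lies in \<open>A\<close> is outside \<open>B\<close> and so is counted on the right
  by \<open>nbhd E B\<close>; a point counted twice on the left is adjacent to \<open>A \<inter> B\<close> and outside
  \<open>A \<union> B\<close>, so it is counted twice on the right.\<close>

lemma card_nbhd_submodular:
  assumes "finite V" "\<Union>E \<subseteq> V"
  shows "card (nbhd E (A \<inter> B)) + card (nbhd E (A \<union> B)) \<le> card (nbhd E A) + card (nbhd E B)"
proof -
  have fin: "finite (nbhd E X)" for X
    using nbhd_subset[OF assms(2)] assms(1) by (rule finite_subset)
  have "nbhd E (A \<inter> B) \<union> nbhd E (A \<union> B) \<subseteq> nbhd E A \<union> nbhd E B"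
    and "nbhd E (A \<inter> B) \<inter> nbhd E (A \<union> B) \<subseteq> nbhd E A \<inter> nbhd E B"
    unfolding nbhd_def by blast+
  then have "card (nbhd E (A \<inter> B) \<union> nbhd E (A \<union> B)) + card (nbhd E (A \<inter> B) \<inter> nbhd E (A \<union> B))
      \<le> card (nbhd E A \<union> nbhd E B) + card (nbhd E A \<inter> nbhd E B)"
    using fin by (intro add_mono card_mono) auto
  then show ?thesis
    unfolding card_Un_Int[OF fin fin, symmetric] .
qed

lemma atom_exists:
  assumes "separating V E X"
  obtains A where "atom V E A"
proof -
  obtain Y where Y: "separating V E Y"
      "\<And>Z. separating V E Z \<Longrightarrow> card (nbhd E Y) \<le> card (nbhd E Z)"
    using ex_has_least_nat[of "separating V E" X "\<lambda>Z. card (nbhd E Z)"] assms by blast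
  obtain A where "separating V E A \<and> card (nbhd E A) = card (nbhd E Y)"
      "\<And>Z. separating V E Z \<and> card (nbhd E Z) = card (nbhd E Y) \<Longrightarrow> card A \<le> card Z"
    using ex_has_least_nat
      [of "\<lambda>Z. separating V E Z \<and> card (nbhd E Z) = card (nbhd E Y)" Y card] Y(1) by blast
  then have "atom V E A"
    unfolding atom_def using Y(2) by metis
  then show thesis by (rule that)
qed

text \<open>The exterior of an atom \<open>A\<close> is itself separating and its boundary lies in that of \<open>A\<close>, so it
  competes with \<open>A\<close> in the choice of an atom.\<close>

lemma atom_card_le_exterior:
  assumes "finite V" "\<Union>E \<subseteq> V" "atom V E A"
  shows "card A \<le> card (V - A - nbhd E A)"
proof -
  let ?C = "V - A - nbhd E A"
  have sub: "nbhd E ?C \<subseteq> nbhd E A"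
  proof
    fix y assume "y \<in> nbhd E ?C"
    then obtain x where x: "x \<in> ?C" "{x, y} \<in> E" and y: "y \<notin> ?C"
      unfolding nbhd_def by blast
    then have "y \<in> V" "{y, x} \<in> E" using assms(2) by (auto simp: insert_commute)
    with x y show "y \<in> nbhd E A" unfolding nbhd_def by blast
  qed
  have A: "A \<subseteq> V" "A \<noteq> {}" "?C \<noteq> {}"
    using assms(3) by (auto simp: atom_def separating_def)
  have "A \<subseteq> V - ?C - nbhd E ?C"
    using A(1) sub nbhd_disjoint[of A E] by blast
  with A have "separating V E ?C"
    unfolding separating_def by blast
  moreover have "card (nbhd E ?C) \<le> card (nbhd E A)"
    using card_mono[OF finite_subset[OF nbhd_subset[OF assms(2)] assms(1)] sub] .
  ultimately show ?thesis
    using assms(3) unfolding atom_def by (metis le_antisym)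
qed

text \<open>If \<open>A\<close> and \<open>B\<close> are distinct and meet, then \<open>A \<inter> B\<close> is too small to be an atom, so its
  boundary is larger than theirs. By submodularity the boundary of \<open>A \<union> B\<close> is smaller than
  theirs, so \<open>A \<union> B\<close> cannot be separating and, with its boundary, covers all vertices. Counting
  shows that this leaves too little room for the exterior of \<open>A\<close>.\<close>

lemma atoms_disjoint:
  assumes fin: "finite V" and E: "\<Union>E \<subseteq> V" and A: "atom V E A" and B: "atom V E B"
    and "A \<noteq> B"
  shows "A \<inter> B = {}"
proof (rule ccontr)
  assume ne: "A \<inter> B \<noteq> {}"
  have sA: "separating V E A" and sB: "separating V E B"
    using A B by (auto simp: atom_def)
  have eqN: "card (nbhd E A) = card (nbhd E B)"
    using A B sA sB unfolding atom_def by (meson le_antisym)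
  then have eqc: "card A = card B"
    using A B sA sB unfolding atom_def by (metis le_antisym)
  have AV: "A \<subseteq> V" "B \<subseteq> V" using sA sB by (auto simp: separating_def)
  then have finA: "finite A" "finite B" using fin finite_subset by auto
  have less: "card (A \<inter> B) < card A"
  proof -
    have "A \<inter> B \<noteq> A"
      using card_subset_eq[OF finA(2), of A] eqc \<open>A \<noteq> B\<close> by blast
    then show ?thesis using finA by (intro psubset_card_mono) auto
  qed
  have "V - A - nbhd E A \<subseteq> V - (A \<inter> B) - nbhd E (A \<inter> B)"
    unfolding nbhd_def by blast
  then have "separating V E (A \<inter> B)"
    using ne AV sA unfolding separating_def by blast
  then have "card (nbhd E A) < card (nbhd E (A \<inter> B))"
    using A less unfolding atom_def by (metis le_neq_implies_less not_le)
  with card_nbhd_submodular[OF fin E, of A B] eqN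
  have small: "card (nbhd E (A \<union> B)) < card (nbhd E A)" by linarith
  then have "\<not> separating V E (A \<union> B)"
    using A unfolding atom_def by (meson not_le)
  then have cover: "V \<subseteq> (A \<union> B) \<union> nbhd E (A \<union> B)"
    using AV ne unfolding separating_def by blast
  have finN: "finite (nbhd E X)" for X
    using finite_subset[OF nbhd_subset[OF E] fin] .
  have "card V \<le> card (A \<union> B) + card (nbhd E (A \<union> B))"
    using card_mono[OF _ cover] card_Un_le[of "A \<union> B" "nbhd E (A \<union> B)"] finA finN
    by (meson finite_UnI le_trans)
  moreover have "card (A \<union> B) \<le> 2 * card A"
    using card_Un_le[of A B] eqc by simp
  moreover have "card V = card A + card (nbhd E A) + card (V - A - nbhd E A)"
  proof -
    have "card (A \<union> nbhd E A) = card A + card (nbhd E A)"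
      using card_Un_disjoint[OF finA(1) finN nbhd_disjoint] .
    moreover have "card V = card (A \<union> nbhd E A) + card (V - (A \<union> nbhd E A))"
      using AV(1) nbhd_subset[OF E, of A] fin
      by (metis Un_least card_Diff_subset card_mono finite_subset le_add_diff_inverse)
    ultimately show ?thesis by (simp add: set_diff_eq)
  qed
  ultimately show False
    using small atom_card_le_exterior[OF fin E A] by linarith
qed

lemma nbhd_image:
  assumes E: "\<Union>E \<subseteq> V" and g: "bij_betw g V V" and X: "X \<subseteq> V"
    and aut: "\<And>x y. x \<in> V \<Longrightarrow> y \<in> V \<Longrightarrow> {g x, g y} \<in> E \<longleftrightarrow> {x, y} \<in> E"
  shows "nbhd E (g ` X) = g ` nbhd E X"
proof
  show "nbhd E (g ` X) \<subseteq> g ` nbhd E X"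
  proof
    fix z assume z: "z \<in> nbhd E (g ` X)"
    then have "z \<in> V" using nbhd_subset[OF E] by blast
    then obtain y where y: "y \<in> V" "z = g y" using g by (auto simp: bij_betw_def)
    obtain x where x: "x \<in> X" "{g x, z} \<in> E" and "z \<notin> g ` X"
      using z unfolding nbhd_def by blast
    then have "y \<notin> X" using y(2) by blast
    moreover have "{x, y} \<in> E" using aut[of x y] x y X by (simp add: subset_iff)
    ultimately have "y \<in> nbhd E X" using x(1) unfolding nbhd_def by blast
    then show "z \<in> g ` nbhd E X" using y(2) by (rule rev_image_eqI)
  qed
  show "g ` nbhd E X \<subseteq> nbhd E (g ` X)"
  proof
    fix z assume "z \<in> g ` nbhd E X"
    then obtain y where y: "z = g y" "y \<in> nbhd E X" by (rule imageE)
    then obtain x where x: "y \<notin> X" "x \<in> X" "{x, y} \<in> E"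
      unfolding nbhd_def by blast
    then have V: "y \<in> V" "x \<in> V" using E by auto
    have "g y \<notin> g ` X"
      using inj_on_image_mem_iff[OF bij_betw_imp_inj_on[OF g] V(1) X] x(1) by simp
    moreover have "{g x, g y} \<in> E" using aut[OF V(2,1)] x(3) by simp
    ultimately show "z \<in> nbhd E (g ` X)"
      unfolding y(1) nbhd_def using x(2) by blast
  qed
qed

lemma atom_image:
  assumes fin: "finite V" and E: "\<Union>E \<subseteq> V" and g: "bij_betw g V V" and A: "atom V E A"
    and aut: "\<And>x y. x \<in> V \<Longrightarrow> y \<in> V \<Longrightarrow> {g x, g y} \<in> E \<longleftrightarrow> {x, y} \<in> E"
  shows "atom V E (g ` A)"
proof -
  have AV: "A \<subseteq> V" and "A \<noteq> {}" and ext: "V - A - nbhd E A \<noteq> {}"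
    using A by (auto simp: atom_def separating_def)
  have inj: "inj_on g V" and gV: "g ` V = V" using g by (auto simp: bij_betw_def)
  have N: "nbhd E (g ` A) = g ` nbhd E A" using nbhd_image[OF E g AV aut] .
  have NV: "nbhd E A \<subseteq> V" using nbhd_subset[OF E] .
  have "V - g ` A - nbhd E (g ` A) = g ` (V - A - nbhd E A)"
    unfolding N using inj_on_image_set_diff[OF inj Diff_subset AV]
      inj_on_image_set_diff[OF inj _ NV, of "V - A"] gV by auto
  moreover have "g ` A \<subseteq> V" using image_mono[OF AV, of g] gV by simp
  ultimately have sep: "separating V E (g ` A)"
    using \<open>A \<noteq> {}\<close> ext unfolding separating_def by simp
  have cards: "card (nbhd E (g ` A)) = card (nbhd E A)" "card (g ` A) = card A"
    using N card_image[OF inj_on_subset[OF inj NV]] card_image[OF inj_on_subset[OF inj AV]]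
    by auto
  show ?thesis
    unfolding atom_def cards using A sep unfolding atom_def by blast
qed

lemma card_edges_at:
  assumes "\<And>e. e \<in> E \<Longrightarrow> card e = 2"
  shows "card {e \<in> E. v \<in> e} = card (nbhd E {v})"
proof -
  have "bij_betw (\<lambda>y. {v, y}) (nbhd E {v}) {e \<in> E. v \<in> e}"
  proof (rule bij_betw_imageI)
    show "inj_on (\<lambda>y. {v, y}) (nbhd E {v})"
      by (rule inj_onI) (simp add: doubleton_eq_iff, blast)
    show "(\<lambda>y. {v, y}) ` nbhd E {v} = {e \<in> E. v \<in> e}"
    proof
      show "(\<lambda>y. {v, y}) ` nbhd E {v} \<subseteq> {e \<in> E. v \<in> e}"
        unfolding nbhd_def by blast
      show "{e \<in> E. v \<in> e} \<subseteq> (\<lambda>y. {v, y}) ` nbhd E {v}"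
      proof
        fix e assume "e \<in> {e \<in> E. v \<in> e}"
        then have e: "e \<in> E" "v \<in> e" "card e = 2" using assms by auto
        then have "card (e - {v}) = 1" by simp
        then obtain y where "e - {v} = {y}" using card_1_singletonE by blast
        then have "e = {v, y}" "y \<noteq> v" using e(2) by blast+
        with e(1) have "y \<in> nbhd E {v}" unfolding nbhd_def by simp
        with \<open>e = {v, y}\<close> show "e \<in> (\<lambda>y. {v, y}) ` nbhd E {v}" by (rule rev_image_eqI[rotated])
      qed
    qed
  qed
  then show ?thesis by (rule bij_betw_same_card[symmetric])
qed

text \<open>If all degrees were different, every value from 0 to \<open>card V - 1\<close> would be a degree, but an
  isolated vertex and a vertex adjacent to all others cannot coexist.\<close>

lemma degrees_not_distinct:
  assumes fin: "finite V" and E: "\<Union>E \<subseteq> V" and two: "card V \<ge> 2"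
  shows "\<not> inj_on (\<lambda>v. card (nbhd E {v})) V"
proof
  let ?deg = "\<lambda>v. card (nbhd E {v})"
  assume inj: "inj_on ?deg V"
  have sub: "nbhd E {v} \<subseteq> V - {v}" for v
    using nbhd_subset[OF E] nbhd_disjoint[of "{v}" E] by blast
  have le: "?deg v \<le> card V - 1" if "v \<in> V" for v
    using card_mono[OF _ sub[of v]] fin that by simp
  have "?deg ` V \<subseteq> {..<card V}" using le two by fastforce
  moreover have "card (?deg ` V) = card {..<card V}" using card_image[OF inj] by simp
  ultimately have img: "?deg ` V = {..<card V}" by (simp add: card_subset_eq)
  have "0 \<in> ?deg ` V" unfolding img using two by simp
  then obtain u where u: "0 = ?deg u" "u \<in> V" by (rule imageE)
  have "card V - 1 \<in> ?deg ` V" unfolding img using two by simp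
  then obtain w where w: "card V - 1 = ?deg w" "w \<in> V" by (rule imageE)
  have "?deg u \<noteq> ?deg w" using u(1) w(1) two by linarith
  then have "u \<noteq> w" by blast
  have "card (V - {w}) = card V - 1" using w(2) by simp
  then have "nbhd E {w} = V - {w}"
    using card_subset_eq[OF finite_Diff[OF fin] sub[of w]] w(1) by simp
  then have "{w, u} \<in> E" using u(2) \<open>u \<noteq> w\<close> unfolding nbhd_def by blast
  then have "w \<in> nbhd E {u}"
    using \<open>u \<noteq> w\<close> unfolding nbhd_def by (simp add: insert_commute)
  moreover have "nbhd E {u} = {}"
    using u(1) finite_subset[OF nbhd_subset[OF E] fin, of "{u}"] by simp
  ultimately show False by blast
qed

section \<open>Permutation groups and blocks\<close>

lemma permutation_group_bij:
  assumes "permutation_group \<Omega> G" "g \<in> G"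
  shows "bij_betw g \<Omega> \<Omega>"
  using assms subgroup.subset[of G "BijGroup \<Omega>"]
  by (auto simp: permutation_group_def BijGroup_def Bij_def)

lemma permutation_group_one:
  assumes "permutation_group \<Omega> G"
  shows "\<exists>e\<in>G. \<forall>x\<in>\<Omega>. e x = x"
proof (intro bexI ballI)
  show "(\<lambda>x\<in>\<Omega>. x) \<in> G"
    using assms subgroup.one_closed[of G "BijGroup \<Omega>"]
    by (auto simp: permutation_group_def BijGroup_def)
qed simp_all

lemma permutation_group_mult:
  assumes "permutation_group \<Omega> G" "g \<in> G" "h \<in> G"
  shows "\<exists>k\<in>G. \<forall>x\<in>\<Omega>. k x = g (h x)"
proof (intro bexI ballI)
  have "g \<in> Bij \<Omega>" "h \<in> Bij \<Omega>"
    using assms subgroup.subset[of G "BijGroup \<Omega>"]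
    by (auto simp: permutation_group_def BijGroup_def)
  then show "compose \<Omega> g h \<in> G"
    using assms subgroup.m_closed[of G "BijGroup \<Omega>" g h]
    by (simp add: permutation_group_def BijGroup_def)
qed (simp add: compose_def)

lemma permutation_group_inverse:
  assumes "permutation_group \<Omega> G" "g \<in> G"
  shows "\<exists>h\<in>G. \<forall>x\<in>\<Omega>. h (g x) = x \<and> g (h x) = x"
proof (intro bexI ballI conjI)
  have bij: "bij_betw g \<Omega> \<Omega>" using permutation_group_bij[OF assms] .
  have "g \<in> Bij \<Omega>"
    using assms subgroup.subset[of G "BijGroup \<Omega>"]
    by (auto simp: permutation_group_def BijGroup_def)
  then show "(\<lambda>x\<in>\<Omega>. inv_into \<Omega> g x) \<in> G"
    using assms subgroup.m_inv_closed[of G "BijGroup \<Omega>" g]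
    by (simp add: permutation_group_def inv_BijGroup)
  show "(\<lambda>x\<in>\<Omega>. inv_into \<Omega> g x) (g x) = x" if "x \<in> \<Omega>" for x
    using bij that by (auto simp: bij_betw_def)
  show "g ((\<lambda>x\<in>\<Omega>. inv_into \<Omega> g x) x) = x" if "x \<in> \<Omega>" for x
    using bij that by (simp add: bij_betw_inv_into_right)
qed

text \<open>The images of a block, together with the remaining points as singletons, form a preserved
  partition. Remaining points do occur: the trivial group on two points is primitive and not
  transitive.\<close>

lemma primitive_block:
  assumes prim: "primitive_group \<Omega> G" and B: "B \<subseteq> \<Omega>" "B \<noteq> {}"
    and block: "\<And>g. g \<in> G \<Longrightarrow> g ` B = B \<or> g ` B \<inter> B = {}"
  shows "(\<exists>x. B = {x}) \<or> B = \<Omega>"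
proof -
  have pg: "permutation_group \<Omega> G" using prim by (simp add: primitive_group_def)
  define T where "T = (\<lambda>g. g ` B) ` G"
  define P where "P = T \<union> (\<lambda>x. {x}) ` (\<Omega> - \<Union>T)"
  have im: "g ` \<Omega> = \<Omega>" if "g \<in> G" for g
    using permutation_group_bij[OF pg that] by (simp add: bij_betw_def)
  have BT: "B \<in> T"
  proof -
    obtain e where "e \<in> G" "\<And>x. x \<in> \<Omega> \<Longrightarrow> e x = x" using permutation_group_one[OF pg] by blast
    then have "e ` B = B" using B by force
    with \<open>e \<in> G\<close> show ?thesis unfolding T_def by force
  qed
  have T\<Omega>: "X \<subseteq> \<Omega>" if "X \<in> T" for X
    using that B im unfolding T_def by blast
  have T_image: "g ` X \<in> T" if gX: "g \<in> G" "X \<in> T" for g X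
  proof -
    obtain h where h: "h \<in> G" "X = h ` B" using gX(2) unfolding T_def by blast
    obtain k where k: "k \<in> G" "\<And>x. x \<in> \<Omega> \<Longrightarrow> k x = g (h x)"
      using permutation_group_mult[OF pg gX(1) h(1)] by blast
    have "k ` B = g ` X" unfolding h(2) image_image using k(2) B(1) by (intro image_cong) auto
    then show ?thesis using k(1) unfolding T_def by blast
  qed
  have T_meet: "X = B" if "X \<in> T" "X \<inter> B \<noteq> {}" for X
    using that block unfolding T_def by blast
  have T_disj: "X = Y" if XY: "X \<in> T" "Y \<in> T" "X \<inter> Y \<noteq> {}" for X Y
  proof -
    obtain g where g: "g \<in> G" "X = g ` B" using XY(1) unfolding T_def by blast
    obtain h where h: "h \<in> G" "\<And>x. x \<in> \<Omega> \<Longrightarrow> h (g x) = x" "\<And>x. x \<in> \<Omega> \<Longrightarrow> g (h x) = x"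
      using permutation_group_inverse[OF pg g(1)] by blast
    have hX: "h ` X = B" unfolding g(2) image_image using h(2) B(1) by (auto simp: subset_iff)
    then have "h ` Y \<inter> B \<noteq> {}" using XY(3) by blast
    then have "h ` Y = B" using T_meet T_image[OF h(1) XY(2)] by blast
    moreover have "g ` h ` Z = Z" if "Z \<subseteq> \<Omega>" for Z
      unfolding image_image using that h(3) by (auto simp: subset_iff)
    ultimately show ?thesis using hX T\<Omega> XY by metis
  qed
  have P\<Omega>: "X \<subseteq> \<Omega>" if "X \<in> P" for X
    using that T\<Omega> unfolding P_def by blast
  have "partition_on \<Omega> P"
  proof (rule partition_onI)
    show "\<Union>P = \<Omega>" using T\<Omega> unfolding P_def by auto
    show "{} \<notin> P"
      using B(2) unfolding P_def T_def by auto
    show "disjnt p q" if "p \<in> P" "q \<in> P" "p \<noteq> q" for p q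
      using that T_disj[of p q] unfolding P_def disjnt_def by auto
  qed
  moreover have "preserves_partition G P"
  proof -
    have sub: "g ` X \<in> P" if g: "g \<in> G" and X: "X \<in> P" for g X
    proof (cases "X \<in> T")
      case True
      then show ?thesis using T_image[OF g] unfolding P_def by blast
    next
      case False
      then obtain x where x: "X = {x}" "x \<in> \<Omega>" "x \<notin> \<Union>T" using X unfolding P_def by blast
      obtain h where h: "h \<in> G" "\<And>x. x \<in> \<Omega> \<Longrightarrow> h (g x) = x"
        using permutation_group_inverse[OF pg g] by blast
      have "g x \<notin> \<Union>T"
      proof
        assume "g x \<in> \<Union>T"
        then obtain Y where "Y \<in> T" "g x \<in> Y" by blast
        then have "h ` Y \<in> T" "x \<in> h ` Y" using T_image[OF h(1)] h(2) x(2) by force+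
        with x(3) show False by blast
      qed
      moreover have "g x \<in> \<Omega>" using im[OF g] x(2) by blast
      ultimately show ?thesis using x(1) unfolding P_def by auto
    qed
    have "(\<lambda>X. g ` X) ` P = P" if g: "g \<in> G" for g
    proof
      show "(\<lambda>X. g ` X) ` P \<subseteq> P" using sub[OF g] by blast
      obtain h where h: "h \<in> G" "\<And>x. x \<in> \<Omega> \<Longrightarrow> g (h x) = x"
        using permutation_group_inverse[OF pg g] by blast
      show "P \<subseteq> (\<lambda>X. g ` X) ` P"
      proof
        fix X assume X: "X \<in> P"
        have "X = g ` h ` X"
          unfolding image_image using P\<Omega>[OF X] h(2) by (auto simp: subset_iff)
        then show "X \<in> (\<lambda>X. g ` X) ` P" using sub[OF h(1) X] by blast
      qed
    qed
    then show ?thesis unfolding preserves_partition_def by blast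
  qed
  ultimately have "P = (\<lambda>x. {x}) ` \<Omega> \<or> P = {\<Omega>}"
    using prim unfolding primitive_group_def by blast
  moreover have "B \<in> P" using BT unfolding P_def by blast
  ultimately show ?thesis by blast
qed

section \<open>Orbital graphs of primitive groups\<close>

lemma orbital_graphs_iff:
  "E \<in> orbital_graphs \<Omega> G \<longleftrightarrow> (\<exists>A. A \<subseteq> \<Omega> \<and> card A = 2 \<and> E = (\<lambda>g. g ` A) ` G)"
  unfolding orbital_graphs_def orbits_def orbit_def by auto

lemma orbital_graph_edge:
  assumes "permutation_group \<Omega> G" "E \<in> orbital_graphs \<Omega> G" "e \<in> E"
  shows "e \<subseteq> \<Omega>" "card e = 2"
proof -
  obtain A g where A: "A \<subseteq> \<Omega>" "card A = 2" "g \<in> G" "e = g ` A"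
    using assms(2,3) by (auto simp: orbital_graphs_iff)
  have g: "bij_betw g \<Omega> \<Omega>" using permutation_group_bij[OF assms(1) A(3)] .
  then show "e \<subseteq> \<Omega>" using A by (auto simp: bij_betw_def)
  show "card e = 2"
    using card_image[OF inj_on_subset[OF bij_betw_imp_inj_on[OF g] A(1)]] A by simp
qed

lemma orbital_graph_invariant:
  assumes pg: "permutation_group \<Omega> G" and E: "E \<in> orbital_graphs \<Omega> G"
    and "g \<in> G" "x \<in> \<Omega>" "y \<in> \<Omega>"
  shows "{g x, g y} \<in> E \<longleftrightarrow> {x, y} \<in> E"
proof -
  obtain A where A: "A \<subseteq> \<Omega>" "E = (\<lambda>g. g ` A) ` G"
    using E by (auto simp: orbital_graphs_iff)
  have *: "k ` e \<in> E" if "k \<in> G" "e \<in> E" for k e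
  proof -
    obtain m where m: "m \<in> G" "e = m ` A" using A(2) \<open>e \<in> E\<close> by blast
    obtain j where j: "j \<in> G" "\<And>x. x \<in> \<Omega> \<Longrightarrow> j x = k (m x)"
      using permutation_group_mult[OF pg \<open>k \<in> G\<close> m(1)] by blast
    have "j ` A = k ` e" unfolding m(2) image_image using j(2) A(1) by (intro image_cong) auto
    then show ?thesis using j(1) A(2) by blast
  qed
  obtain h where h: "h \<in> G" "\<And>x. x \<in> \<Omega> \<Longrightarrow> h (g x) = x"
    using permutation_group_inverse[OF pg \<open>g \<in> G\<close>] by blast
  show ?thesis
    using *[OF \<open>g \<in> G\<close>, of "{x, y}"] *[OF h(1), of "{g x, g y}"] h(2) assms(4,5) by auto
qed

text \<open>The vertices of a given degree form a set invariant under the group, in particular a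
  block. Two vertices have the same degree, and their block cannot be a singleton.\<close>

lemma orbital_graph_regular:
  assumes prim: "primitive_group \<Omega> G" and two: "card \<Omega> \<ge> 2" and E: "E \<in> orbital_graphs \<Omega> G"
  shows "\<exists>r. (\<forall>v\<in>\<Omega>. card (nbhd E {v}) = r) \<and> has_valency \<Omega> E r \<and> 1 \<le> r \<and> r < card \<Omega>"
proof -
  have pg: "permutation_group \<Omega> G" using prim by (simp add: primitive_group_def)
  have fin: "finite \<Omega>" using pg by (simp add: permutation_group_def)
  have E\<Omega>: "\<Union>E \<subseteq> \<Omega>" using orbital_graph_edge(1)[OF pg E] by blast
  obtain u w where uw: "u \<in> \<Omega>" "w \<in> \<Omega>" "u \<noteq> w" "card (nbhd E {u}) = card (nbhd E {w})"
    using degrees_not_distinct[OF fin E\<Omega> two] by (auto simp: inj_on_def)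
  define B where "B = {v \<in> \<Omega>. card (nbhd E {v}) = card (nbhd E {u})}"
  have deg: "card (nbhd E {g v}) = card (nbhd E {v})" if "g \<in> G" "v \<in> \<Omega>" for g v
  proof -
    have g: "bij_betw g \<Omega> \<Omega>" using permutation_group_bij[OF pg \<open>g \<in> G\<close>] .
    have "nbhd E (g ` {v}) = g ` nbhd E {v}"
      using nbhd_image[OF E\<Omega> g, of "{v}"] that orbital_graph_invariant[OF pg E \<open>g \<in> G\<close>]
      by blast
    then show ?thesis
      using card_image[OF inj_on_subset[OF bij_betw_imp_inj_on[OF g] nbhd_subset[OF E\<Omega>]]] by simp
  qed
  have "g ` B = B" if g: "g \<in> G" for g
  proof (rule endo_inj_surj)
    have bij: "bij_betw g \<Omega> \<Omega>" using permutation_group_bij[OF pg g] .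
    then show "g ` B \<subseteq> B" using deg[OF g] unfolding B_def bij_betw_def by auto
    show "inj_on g B" using bij unfolding B_def bij_betw_def by (auto simp: inj_on_def)
    show "finite B" using fin unfolding B_def by simp
  qed
  then have "(\<exists>x. B = {x}) \<or> B = \<Omega>"
    using primitive_block[OF prim, of B] uw(1) unfolding B_def by blast
  moreover have "u \<in> B" "w \<in> B" using uw unfolding B_def by auto
  ultimately have "B = \<Omega>" using uw(3) by auto
  then have reg: "card (nbhd E {v}) = card (nbhd E {u})" if "v \<in> \<Omega>" for v
    using that unfolding B_def by blast
  have card2: "card e = 2" if "e \<in> E" for e using orbital_graph_edge(2)[OF pg E that] .
  have val: "has_valency \<Omega> E (card (nbhd E {u}))"
    unfolding has_valency_def using reg card_edges_at[OF card2] by auto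
  have lt: "card (nbhd E {u}) < card \<Omega>"
    using nbhd_subset[OF E\<Omega>, of "{u}"] nbhd_disjoint[of "{u}" E] uw(1) fin
    by (intro psubset_card_mono) auto
  obtain e where "e \<in> E"
    using E permutation_group_one[OF pg] unfolding orbital_graphs_iff by blast
  then obtain x y where xy: "e = {x, y}" "x \<noteq> y" using card2 by (meson card_2_iff)
  then have "y \<in> nbhd E {x}" "x \<in> \<Omega>"
    using \<open>e \<in> E\<close> E\<Omega> unfolding nbhd_def by auto
  then have "card (nbhd E {x}) \<noteq> 0"
    using finite_subset[OF nbhd_subset[OF E\<Omega>] fin, of "{x}"] by auto
  then have "1 \<le> card (nbhd E {u})" using reg[OF \<open>x \<in> \<Omega>\<close>] by simp
  with reg val lt show ?thesis by blast
qed

text \<open>Distinct images of an atom are disjoint, so an atom is a block; it is not all of \<open>\<Omega>\<close> because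
  it separates, so it is a single vertex, whose boundary has as many points as the valency.\<close>

lemma orbital_graph_connectivity:
  assumes prim: "primitive_group \<Omega> G" and E: "E \<in> orbital_graphs \<Omega> G"
    and val: "\<And>v. v \<in> \<Omega> \<Longrightarrow> card (nbhd E {v}) = r" and X: "separating \<Omega> E X"
  shows "r \<le> card (nbhd E X)"
proof -
  have pg: "permutation_group \<Omega> G" using prim by (simp add: primitive_group_def)
  have fin: "finite \<Omega>" using pg by (simp add: permutation_group_def)
  have E\<Omega>: "\<Union>E \<subseteq> \<Omega>" using orbital_graph_edge(1)[OF pg E] by blast
  obtain A where A: "atom \<Omega> E A" using atom_exists[OF X] .
  then have A\<Omega>: "A \<subseteq> \<Omega>" "A \<noteq> {}" "A \<noteq> \<Omega>" by (auto simp: atom_def separating_def)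
  have "g ` A = A \<or> g ` A \<inter> A = {}" if g: "g \<in> G" for g
    using atoms_disjoint[OF fin E\<Omega> _ A]
      atom_image[OF fin E\<Omega> permutation_group_bij[OF pg g] A orbital_graph_invariant[OF pg E g]]
    by blast
  then obtain v where "A = {v}" using primitive_block[OF prim A\<Omega>(1,2)] A\<Omega>(3) by blast
  with A\<Omega>(1) val have "card (nbhd E A) = r" by simp
  with A X show ?thesis unfolding atom_def by blast
qed

lemma min_orbital_valency_attained:
  assumes prim: "primitive_group \<Omega> G" and two: "card \<Omega> \<ge> 2"
  obtains E where "E \<in> orbital_graphs \<Omega> G" "has_valency \<Omega> E (min_orbital_valency \<Omega> G)"
proof -
  obtain A where "A \<subseteq> \<Omega>" "card A = 2" using obtain_subset_with_card_n[OF two] by blast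
  then have "(\<lambda>g. g ` A) ` G \<in> orbital_graphs \<Omega> G" by (auto simp: orbital_graphs_iff)
  then obtain r where "\<exists>E\<in>orbital_graphs \<Omega> G. has_valency \<Omega> E r"
    using orbital_graph_regular[OF prim two] by blast
  then have "\<exists>E\<in>orbital_graphs \<Omega> G. has_valency \<Omega> E (min_orbital_valency \<Omega> G)"
    unfolding min_orbital_valency_def by (rule LeastI)
  then show thesis using that by blast
qed

lemma min_orbital_valency_le:
  "E \<in> orbital_graphs \<Omega> G \<Longrightarrow> has_valency \<Omega> E r \<Longrightarrow> min_orbital_valency \<Omega> G \<le> r"
  unfolding min_orbital_valency_def by (rule Least_le) blast

section \<open>The universal transversal property for pairs\<close>

lemma two_partition_iff:
  "k_partition 2 B P \<longleftrightarrow>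
     (\<exists>X Y. P = {X, Y} \<and> X \<noteq> {} \<and> Y \<noteq> {} \<and> X \<inter> Y = {} \<and> X \<union> Y = B)"
proof
  assume "k_partition 2 B P"
  then have P: "partition_on B P" "card P = 2" by (auto simp: k_partition_def)
  then obtain X Y where "P = {X, Y}" "X \<noteq> Y" by (meson card_2_iff)
  with P(1) show "\<exists>X Y. P = {X, Y} \<and> X \<noteq> {} \<and> Y \<noteq> {} \<and> X \<inter> Y = {} \<and> X \<union> Y = B"
    by (auto simp: partition_on_def disjoint_def)
next
  assume "\<exists>X Y. P = {X, Y} \<and> X \<noteq> {} \<and> Y \<noteq> {} \<and> X \<inter> Y = {} \<and> X \<union> Y = B"
  then obtain X Y where "P = {X, Y}" "X \<noteq> {}" "Y \<noteq> {}" "X \<inter> Y = {}" "X \<union> Y = B" by blast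
  then show "k_partition 2 B P"
    by (auto simp: k_partition_def partition_on_def disjoint_def card_2_iff)
qed

lemma transversal_pair_iff:
  assumes "card e = 2" "X \<inter> Y = {}"
  shows "transversal {X, Y} e \<longleftrightarrow> (\<exists>x\<in>X. \<exists>y\<in>Y. e = {x, y})"
proof
  assume "transversal {X, Y} e"
  then have "\<exists>!x. x \<in> e \<inter> X" "\<exists>!y. y \<in> e \<inter> Y" unfolding transversal_def by simp_all
  then obtain x y where xy: "x \<in> e" "x \<in> X" "y \<in> e" "y \<in> Y"
    by (elim ex1E) blast
  have "x \<noteq> y" using xy assms(2) by blast
  then have "card {x, y} = card e" using assms(1) by simp
  moreover have "finite e" using assms(1) by (intro card_ge_0_finite) simp
  moreover have "{x, y} \<subseteq> e" using xy by simp
  ultimately have "e = {x, y}" using card_subset_eq[of e "{x, y}"] by simp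
  with xy(2,4) show "\<exists>x\<in>X. \<exists>y\<in>Y. e = {x, y}" by blast
next
  assume "\<exists>x\<in>X. \<exists>y\<in>Y. e = {x, y}"
  then obtain x y where xy: "x \<in> X" "y \<in> Y" "e = {x, y}" by blast
  then have "e \<inter> X = {x}" "e \<inter> Y = {y}" using assms(2) by auto
  then have "\<exists>!a. a \<in> e \<inter> X" "\<exists>!a. a \<in> e \<inter> Y" by (simp_all only: singleton_iff) simp_all
  then show "transversal {X, Y} e" unfolding transversal_def by simp
qed

text \<open>The right-hand side says that every orbital graph induces a connected graph on every set of
  \<open>l\<close> vertices, so that only vertex connectivity remains to be studied.\<close>

lemma universal_transversal_two_iff:
  assumes pg: "permutation_group \<Omega> G"
  shows "universal_transversal \<Omega> G 2 l \<longleftrightarrow>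
    (\<forall>E\<in>orbital_graphs \<Omega> G. \<forall>X Y. X \<union> Y \<subseteq> \<Omega> \<and> card (X \<union> Y) = l \<and> X \<noteq> {} \<and> Y \<noteq> {} \<and> X \<inter> Y = {}
       \<longrightarrow> (\<exists>x\<in>X. \<exists>y\<in>Y. {x, y} \<in> E))" (is "_ \<longleftrightarrow> ?R")
proof -
  have *: "(\<exists>g\<in>G. transversal {X, Y} (g ` A)) \<longleftrightarrow> (\<exists>x\<in>X. \<exists>y\<in>Y. {x, y} \<in> (\<lambda>g. g ` A) ` G)"
    if A: "A \<subseteq> \<Omega>" "card A = 2" and XY: "X \<inter> Y = {}" for A X Y
  proof -
    have "transversal {X, Y} (g ` A) \<longleftrightarrow> (\<exists>x\<in>X. \<exists>y\<in>Y. g ` A = {x, y})" if "g \<in> G" for g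
    proof (rule transversal_pair_iff[OF _ XY])
      have "(\<lambda>g. g ` A) ` G \<in> orbital_graphs \<Omega> G" using A by (auto simp: orbital_graphs_iff)
      then show "card (g ` A) = 2" using orbital_graph_edge(2)[OF pg] that by blast
    qed
    then have "(\<exists>g\<in>G. transversal {X, Y} (g ` A)) \<longleftrightarrow> (\<exists>g\<in>G. \<exists>x\<in>X. \<exists>y\<in>Y. g ` A = {x, y})"
      by (rule bex_cong[OF refl])
    also have "\<dots> \<longleftrightarrow> (\<exists>x\<in>X. \<exists>y\<in>Y. \<exists>g\<in>G. g ` A = {x, y})" by blast
    also have "\<dots> \<longleftrightarrow> (\<exists>x\<in>X. \<exists>y\<in>Y. {x, y} \<in> (\<lambda>g. g ` A) ` G)"
      unfolding image_iff by (intro bex_cong refl eq_commute)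
    finally show ?thesis .
  qed
  show ?thesis
  proof
    assume ut: "universal_transversal \<Omega> G 2 l"
    show ?R
    proof (intro ballI allI impI)
      fix E X Y assume E: "E \<in> orbital_graphs \<Omega> G"
        and XY: "X \<union> Y \<subseteq> \<Omega> \<and> card (X \<union> Y) = l \<and> X \<noteq> {} \<and> Y \<noteq> {} \<and> X \<inter> Y = {}"
      obtain A where A: "A \<subseteq> \<Omega>" "card A = 2" "E = (\<lambda>g. g ` A) ` G"
        using E by (auto simp: orbital_graphs_iff)
      have "k_partition 2 (X \<union> Y) {X, Y}" using XY unfolding two_partition_iff by blast
      then have "\<exists>g\<in>G. transversal {X, Y} (g ` A)"
        using ut[unfolded universal_transversal_def, rule_format, of A "X \<union> Y" "{X, Y}"] A(1,2) XY
        by simp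
      then show "\<exists>x\<in>X. \<exists>y\<in>Y. {x, y} \<in> E" using *[OF A(1,2), of X Y] XY A(3) by simp
    qed
  next
    assume R: ?R
    show "universal_transversal \<Omega> G 2 l"
      unfolding universal_transversal_def
    proof (intro allI impI)
      fix A B P
      assume H: "A \<subseteq> \<Omega> \<and> card A = 2 \<and> B \<subseteq> \<Omega> \<and> card B = l \<and> k_partition 2 B P"
      then obtain X Y where XY: "P = {X, Y}" "X \<noteq> {}" "Y \<noteq> {}" "X \<inter> Y = {}" "X \<union> Y = B"
        unfolding two_partition_iff by blast
      have "(\<lambda>g. g ` A) ` G \<in> orbital_graphs \<Omega> G" using H by (auto simp: orbital_graphs_iff)
      then have "\<exists>x\<in>X. \<exists>y\<in>Y. {x, y} \<in> (\<lambda>g. g ` A) ` G"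
        using R[rule_format, of "(\<lambda>g. g ` A) ` G" X Y] XY(2-5) H by blast
      then show "\<exists>g\<in>G. transversal P (g ` A)" using *[of A X Y] XY(1,4) H by simp
    qed
  qed
qed

theorem proposition4p1:
  fixes \<Omega> :: "'a set" and G :: "('a \<Rightarrow> 'a) set" and n l d :: nat
  assumes "primitive_group \<Omega> G"
    and "card \<Omega> = n" and "n \<ge> 2"
    and "2 \<le> l" and "l \<le> n"
    and "d = min_orbital_valency \<Omega> G"
  shows "(universal_transversal \<Omega> G 2 l \<longleftrightarrow> int l \<ge> int n - int d + 1) \<and>
         int (ut_threshold \<Omega> G 2) = int n - int d + 1"
proof -
  note prim = assms(1)
  have pg: "permutation_group \<Omega> G" using prim by (simp add: primitive_group_def)
  have fin: "finite \<Omega>" using pg by (simp add: permutation_group_def)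
  have two: "card \<Omega> \<ge> 2" using assms by simp
  obtain D where D: "D \<in> orbital_graphs \<Omega> G" "has_valency \<Omega> D d"
    using min_orbital_valency_attained[OF prim two] assms(6) by blast
  obtain v where v: "v \<in> \<Omega>" using two by fastforce
  obtain s where s: "\<And>w. w \<in> \<Omega> \<Longrightarrow> card (nbhd D {w}) = s" "has_valency \<Omega> D s"
      "1 \<le> s" "s < card \<Omega>"
    using orbital_graph_regular[OF prim two D(1)] by blast
  have "s = d"
    using D(2)[unfolded has_valency_def, rule_format, OF v]
      s(2)[unfolded has_valency_def, rule_format, OF v] by simp
  then have degD: "card (nbhd D {v}) = d" and d: "1 \<le> d" "d < n" using s v assms(2) by auto
  have main: "universal_transversal \<Omega> G 2 m \<longleftrightarrow> n - d + 1 \<le> m" if m: "2 \<le> m" "m \<le> n" for m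
  proof
    assume ut: "universal_transversal \<Omega> G 2 m"
    show "n - d + 1 \<le> m"
    proof (rule ccontr)
      assume "\<not> n - d + 1 \<le> m"
      \<comment> \<open>Isolate \<open>v\<close> by choosing the other points among its non-neighbours.\<close>
      have D\<Omega>: "\<Union>D \<subseteq> \<Omega>" using orbital_graph_edge(1)[OF pg D(1)] by blast
      have N: "nbhd D {v} \<subseteq> \<Omega>" using nbhd_subset[OF D\<Omega>] .
      have "card (\<Omega> - nbhd D {v}) = n - d"
        using card_Diff_subset[OF finite_subset[OF N fin] N] degD assms(2) by simp
      moreover have "v \<in> \<Omega> - nbhd D {v}" using v nbhd_disjoint[of "{v}" D] by blast
      ultimately have "card (\<Omega> - nbhd D {v} - {v}) = n - d - 1" by simp
      then have "m - 1 \<le> card (\<Omega> - nbhd D {v} - {v})"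
        using \<open>\<not> n - d + 1 \<le> m\<close> by linarith
      then obtain Y where Y: "Y \<subseteq> \<Omega> - nbhd D {v} - {v}" "card Y = m - 1" "finite Y"
        using obtain_subset_with_card_n by metis
      then have "v \<notin> Y" by blast
      then have "card ({v} \<union> Y) = m" "Y \<noteq> {}" using Y(2,3) m(1) by auto
      then have "\<exists>x\<in>{v}. \<exists>y\<in>Y. {x, y} \<in> D"
        using ut[unfolded universal_transversal_two_iff[OF pg], rule_format, OF D(1), of "{v}" Y]
          Y(1) v \<open>v \<notin> Y\<close> by blast
      with Y(1) show False unfolding nbhd_def by blast
    qed
  next
    assume le: "n - d + 1 \<le> m"
    show "universal_transversal \<Omega> G 2 m"
      unfolding universal_transversal_two_iff[OF pg]
    proof (intro ballI allI impI, rule ccontr)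
      fix E X Y assume E: "E \<in> orbital_graphs \<Omega> G"
        and XY: "X \<union> Y \<subseteq> \<Omega> \<and> card (X \<union> Y) = m \<and> X \<noteq> {} \<and> Y \<noteq> {} \<and> X \<inter> Y = {}"
        and no: "\<not> (\<exists>x\<in>X. \<exists>y\<in>Y. {x, y} \<in> E)"
      have E\<Omega>: "\<Union>E \<subseteq> \<Omega>" using orbital_graph_edge(1)[OF pg E] by blast
      \<comment> \<open>Without an edge to \<open>Y\<close>, all of \<open>Y\<close> is exterior to \<open>X\<close>, and the boundary of \<open>X\<close> lies
         among the at most \<open>d - 1\<close> points outside \<open>X \<union> Y\<close>.\<close>
      obtain r where r: "\<And>w. w \<in> \<Omega> \<Longrightarrow> card (nbhd E {w}) = r" "has_valency \<Omega> E r"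
        using orbital_graph_regular[OF prim two E] by blast
      have N: "nbhd E X \<subseteq> \<Omega> - (X \<union> Y)"
        using nbhd_subset[OF E\<Omega>] no unfolding nbhd_def by blast
      then have "separating \<Omega> E X" using XY unfolding separating_def by blast
      then have "r \<le> card (nbhd E X)"
        using orbital_graph_connectivity[OF prim E r(1)] by blast
      also have "\<dots> \<le> card (\<Omega> - (X \<union> Y))" using card_mono[OF _ N] fin by simp
      also have "\<dots> = n - m"
        using XY card_Diff_subset[of "X \<union> Y" \<Omega>] fin finite_subset assms(2) by metis
      finally have "r \<le> n - m" .
      moreover have "d \<le> r" using min_orbital_valency_le[OF E r(2)] assms(6) by simp
      ultimately show False using le d m by linarith
    qed
  qed
  have "ut_threshold \<Omega> G 2 = n - d + 1"
    unfolding ut_threshold_def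
  proof (rule the_equality)
    show "2 \<le> n - d + 1 \<and> n - d + 1 \<le> card \<Omega> \<and>
        (\<forall>m. 2 \<le> m \<and> m \<le> card \<Omega> \<longrightarrow> (universal_transversal \<Omega> G 2 m \<longleftrightarrow> n - d + 1 \<le> m))"
      using main d assms(2) by auto
  next
    fix t
    assume t: "2 \<le> t \<and> t \<le> card \<Omega> \<and>
        (\<forall>m. 2 \<le> m \<and> m \<le> card \<Omega> \<longrightarrow> (universal_transversal \<Omega> G 2 m \<longleftrightarrow> t \<le> m))"
    \<comment> \<open>Each of the two thresholds lies in the range of \<open>m\<close>, so it satisfies the other's bound.\<close>
    have "n - d + 1 \<le> t" using t main[of t] assms(2) by simp
    moreover have "t \<le> n - d + 1" using t main[of "n - d + 1"] d assms(2) by simp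
    ultimately show "t = n - d + 1" by simp
  qed
  then show ?thesis using main[OF assms(4,5)] d by auto
qed

end
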